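(* Let $(k,\mathcal B)$ be a game board with $\mathcal B=(B_1,\dots,B_n)$ and $1\le n\leq 3$. Let $O$ be the collection of all nonempty $I\subseteq\{1,\dots,n\}$ such that the Venn region of $\mathcal B$ corresponding to $I$ has an odd number of elements. The player with a winning strategy in the splitting game $(k,\mathcal B,t)$ is the same for $t=\mathrm{Split}$ and $t=\mathrm{Skew}$, and is determined as follows. If $n=1$, Split has a winning strategy. If $n=2$, Skew has a winning strategy if $O=\{\{1\},\{2\},\{1,2\}\}$, and Split has a winning strategy otherwise. If $n=3$, Split has a winning strategy if $|O|\le2$ or if, after a permutation of the indices $1,2,3$, $O$ is one of the following ten collections; in all other cases Skew has a winning strategy: (1) $\{\{1\},\{2\},\{3\}\}$; (2) $\{\{1\},\{2\},\{1,3\}\}$; (3) $\{\{1\},\{1,3\},\{1,2,3\}\}$; (4) $\{\{1\},\{1,2\},\{1,3\}\}$; (5) $\{\{1,2\},\{1,3\},\{2,3\},\{1,2,3\}\}$; (6) $\{\{3\},\{2,3\},\{1,2\},\{1,2,3\}\}$; (7) $\{\{2\},\{3\},\{2,3\},\{1,2\}\}$; (8) $\{\{2\},\{3\},\{2,3\},\{1,2,3\}\}$; (9) $\{\{2\},\{3\},\{1,2\},\{1,3\},\{1,2,3\}\}$; (10) $\{\{1\},\{2\},\{3\},\{1,2\},\{1,3\},\{2,3\}\}$. Moreover, whenever every Venn region of $\mathcal B$ of nonzero multiplicity has at most one element, the player identified above has a pairing strategy for $\mathcal B$.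
   Context: Let $[k]=\{1,\dots,k\}$. For $A,B\subseteq[k]$, $A$ splits $B$ if $|A\cap B|=|B|/2$ when $|B|$ is even, and $|A\cap B|\in\{(|B|-1)/2,(|B|+1)/2\}$ when $|B|$ is odd; $A$ splits a family if it splits every member. The splitting game: a game board $(k,\mathcal B)$ consists of a positive integer $k$ and a (finite, indexed, repetitions allowed) family $\mathcal B=(B_1,\dots,B_n)$ of subsets of $[k]$. An instance $(k,\mathcal B,t)$ also specifies $t\in\{\mathrm{Split},\mathrm{Skew}\}$, the player who moves first. Players Split and Skew alternately claim an element of $[k]$, without repetition, until all elements are claimed. Split wins if the set of elements Split claimed splits $\mathcal B$; otherwise Skew wins. The Venn region of $\mathcal B$ corresponding to $I\subseteq\{1,\dots,n\}$ is the set of $x\in[k]$ such that $x\in B_i$ for all $i\in I$ and $x\notin B_i$ for all $i\notin I$; its multiplicity is $|I|$. Split has a pairing strategy for $\mathcal B$ if there is a (possibly empty) set $\mathcal P$ of pairwise disjoint two-element subsets of $[k]$ such that every splitter of $\mathcal P$ (set $A\subseteq[k]$ containing exactly one element of each pair in $\mathcal P$) splits $\mathcal B$. Skew has a pairing strategy for $\mathcal B$ if there is such a $\mathcal P$ for which no splitter of $\mathcal P$ splits $\mathcal B$. *)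

theory Defs
  imports Main "HOL-Library.Disjoint_Sets" "HOL-Combinatorics.Permutations"
begin

text \<open>
  A family \<open>(B\<^sub>1, \<dots>, B\<^sub>n)\<close> is given by \<open>n\<close> and a function \<open>B\<close> on
  indices; every definition below uses \<open>B\<close> only on \<open>{1..n}\<close>.
\<close>

definition splits :: "nat set \<Rightarrow> nat set \<Rightarrow> bool" where
  "splits A B \<longleftrightarrow>
     (if even (card B) then card (A \<inter> B) = card B div 2
      else card (A \<inter> B) \<in> {(card B - 1) div 2, (card B + 1) div 2})"

definition splits_family :: "nat set \<Rightarrow> nat \<Rightarrow> (nat \<Rightarrow> nat set) \<Rightarrow> bool" where
  "splits_family A n B \<longleftrightarrow> (\<forall>i\<in>{1..n}. splits A (B i))"

definition game_board :: "nat \<Rightarrow> nat \<Rightarrow> (nat \<Rightarrow> nat set) \<Rightarrow> bool" where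
  "game_board k n B \<longleftrightarrow> 0 < k \<and> (\<forall>i\<in>{1..n}. B i \<subseteq> {1..k})"

datatype player = Split | Skew

fun opponent :: "player \<Rightarrow> player" where
  "opponent Split = Skew"
| "opponent Skew = Split"

definition mover :: "player \<Rightarrow> nat \<Rightarrow> player" where
  "mover t i = (if even i then t else opponent t)"

text \<open>
  A position is the list of the elements claimed so far, in chronological order;
  its \<open>i\<close>-th entry (from 0) was claimed by \<open>mover t i\<close>.
\<close>

definition position :: "nat \<Rightarrow> nat list \<Rightarrow> bool" where
  "position k h \<longleftrightarrow> distinct h \<and> set h \<subseteq> {1..k}"

definition complete_play :: "nat \<Rightarrow> nat list \<Rightarrow> bool" where
  "complete_play k h \<longleftrightarrow> distinct h \<and> set h = {1..k}"

definition claimed :: "player \<Rightarrow> player \<Rightarrow> nat list \<Rightarrow> nat set" where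
  "claimed t p h = {h ! i | i. i < length h \<and> mover t i = p}"

definition wins_play ::
  "nat \<Rightarrow> (nat \<Rightarrow> nat set) \<Rightarrow> player \<Rightarrow> player \<Rightarrow> nat list \<Rightarrow> bool" where
  "wins_play n B t p h \<longleftrightarrow>
     (case p of Split \<Rightarrow> splits_family (claimed t Split h) n B
              | Skew \<Rightarrow> \<not> splits_family (claimed t Split h) n B)"

text \<open>
  A strategy for \<open>p\<close> must name an unclaimed element at every unfinished position where
  \<open>p\<close> is to move. Otherwise a strategy with no consistent complete play would win vacuously.
\<close>

definition strategy :: "nat \<Rightarrow> player \<Rightarrow> player \<Rightarrow> (nat list \<Rightarrow> nat) \<Rightarrow> bool" where
  "strategy k t p \<sigma> \<longleftrightarrow>
     (\<forall>h. position k h \<and> length h < k \<and> mover t (length h) = p \<longrightarrow> \<sigma> h \<in> {1..k} - set h)"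

definition follows :: "player \<Rightarrow> player \<Rightarrow> (nat list \<Rightarrow> nat) \<Rightarrow> nat list \<Rightarrow> bool" where
  "follows t p \<sigma> h \<longleftrightarrow> (\<forall>i<length h. mover t i = p \<longrightarrow> h ! i = \<sigma> (take i h))"

definition has_winning_strategy ::
  "nat \<Rightarrow> nat \<Rightarrow> (nat \<Rightarrow> nat set) \<Rightarrow> player \<Rightarrow> player \<Rightarrow> bool" where
  "has_winning_strategy k n B t p \<longleftrightarrow>
     (\<exists>\<sigma>. strategy k t p \<sigma> \<and>
          (\<forall>h. complete_play k h \<and> follows t p \<sigma> h \<longrightarrow> wins_play n B t p h))"

definition venn_region :: "nat \<Rightarrow> nat \<Rightarrow> (nat \<Rightarrow> nat set) \<Rightarrow> nat set \<Rightarrow> nat set" where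
  "venn_region k n B I =
     {x \<in> {1..k}. (\<forall>i\<in>I. x \<in> B i) \<and> (\<forall>i\<in>{1..n} - I. x \<notin> B i)}"

definition odd_regions :: "nat \<Rightarrow> nat \<Rightarrow> (nat \<Rightarrow> nat set) \<Rightarrow> nat set set" where
  "odd_regions k n B =
     {I. I \<noteq> {} \<and> I \<subseteq> {1..n} \<and> odd (card (venn_region k n B I))}"

definition pairing :: "nat \<Rightarrow> nat set set \<Rightarrow> bool" where
  "pairing k P \<longleftrightarrow> (\<forall>p\<in>P. p \<subseteq> {1..k} \<and> card p = 2) \<and> disjoint P"

definition splitter :: "nat \<Rightarrow> nat set set \<Rightarrow> nat set \<Rightarrow> bool" where
  "splitter k P A \<longleftrightarrow> A \<subseteq> {1..k} \<and> (\<forall>p\<in>P. card (A \<inter> p) = 1)"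

definition has_pairing_strategy ::
  "nat \<Rightarrow> nat \<Rightarrow> (nat \<Rightarrow> nat set) \<Rightarrow> player \<Rightarrow> bool" where
  "has_pairing_strategy k n B p \<longleftrightarrow>
     (\<exists>P. pairing k P \<and>
          (\<forall>A. splitter k P A \<longrightarrow>
             (case p of Split \<Rightarrow> splits_family A n B
                      | Skew \<Rightarrow> \<not> splits_family A n B)))"

end

theory Submission
  imports Defs
begin

text \<open>
  On every board the player named in the theorem has a pairing strategy; the other claims follow
  from this. A pairing strategy
  yields a winning strategy for either choice of the first mover, by answering each move with its
  partner (\<open>pairing_strategy_imp_winning_strategy\<close>), and both players cannot have winning strategies
  (\<open>at_most_one_winner\<close>).

  Only the parities of the Venn regions matter. Matching the elements inside a
  region cancels their influence on every member of the family, which leaves one representative in each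
  odd region (\<open>region_pairing_imp_pairing_strategy\<close>). What remains is to match some of these
  representatives. A pair with index sets \<open>I\<close> and \<open>J\<close> contributes \<open>\<plusminus>\<close> the difference of the
  indicator vectors of \<open>I\<close> and \<open>J\<close>, and an unmatched representative of \<open>I\<close> contributes
  \<open>\<plusminus>\<close> the indicator vector of \<open>I\<close>. Split succeeds if no sum of
  these vectors, however the signs are chosen, has an entry of absolute value above 1; Skew succeeds if each such sum
  has one.

  Split's matchings arrange that at each index at most one vector is nonzero; one pair
  suffices for at most two odd regions (\<open>few_odd_regions_pairing\<close>), and \<open>split_table\<close> treats the
  ten exceptional collections. Skew exploits that an index where exactly two vectors are nonzero compels Split to
  let them cancel there; \<open>skew_table\<close> lists matchings in which such forced cancellations are incompatible or
  overload another index. Up to renaming the three sets, the two tables cover all collections of more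
  than two regions (\<open>tables_up_to_relabelling\<close>).
\<close>

section \<open>From pairing strategies to winning strategies\<close>

lemma even_card_involution:
  assumes "finite X" "even (card X)"
  obtains e where "\<And>x. x \<in> X \<Longrightarrow> e x \<in> X \<and> e x \<noteq> x \<and> e (e x) = x"
proof -
  obtain m where "card X = 2 * m"
    using assms(2) by blast
  with assms(1) have "\<exists>e. \<forall>x \<in> X. e x \<in> X \<and> e x \<noteq> x \<and> e (e x) = x"
  proof (induction m arbitrary: X)
    case 0
    then show ?case by simp
  next
    case (Suc m)
    then have "card X = Suc (Suc (2 * m))"
      by simp
    then obtain a b Y where X: "X = insert a (insert b Y)" "a \<notin> insert b Y" "b \<notin> Y" "card Y = 2 * m"
      by (metis card_Suc_eq)
    then obtain e where e: "\<forall>x \<in> Y. e x \<in> Y \<and> e x \<noteq> x \<and> e (e x) = x"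
      using Suc.IH[of Y] Suc.prems(1) by auto
    show ?case
      by (rule exI[of _ "\<lambda>x. if x = a then b else if x = b then a else e x"]) (use X e in auto)
  qed
  then show ?thesis
    using that by blast
qed

text \<open>
  Leftover elements are matched among themselves, so that the owner of the pairing has an answer
  to every move. For odd \<open>k\<close> one element remains; it is matched with the
  dummy \<open>0\<close>. For even \<open>k\<close> the dummy is a fixed point, so that
  \<open>e\<close> is an involution of \<open>{0..k}\<close> in both cases.
\<close>

lemma pairing_extends_to_involution:
  assumes "pairing k P"
  obtains e where "\<And>x. x \<le> k \<Longrightarrow> e x \<le> k \<and> e (e x) = x"
    and "\<And>x. x \<in> {1..k} \<Longrightarrow> e x \<noteq> x"
    and "\<And>p. p \<in> P \<Longrightarrow> \<exists>x \<in> {1..k}. e x \<in> {1..k} \<and> p = {x, e x}"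
proof -
  have P: "p \<subseteq> {1..k}" "card p = 2" if "p \<in> P" for p
    using assms that by (auto simp: pairing_def)
  have disj: "p = q" if "p \<in> P" "q \<in> P" "x \<in> p" "x \<in> q" for p q x
    using assms that unfolding pairing_def disjoint_def by blast
  define f where "f x = (SOME y. {x, y} \<in> P)" for x
  have f: "{x, f x} \<in> P" if x: "x \<in> \<Union>P" for x
  proof -
    obtain p where "p \<in> P" "x \<in> p"
      using x by blast
    then have "\<exists>y. {x, y} \<in> P"
      using P(2)[of p] by (auto simp: card_2_iff insert_commute)
    then show ?thesis
      unfolding f_def by (rule someI_ex)
  qed
  have f_unique: "f x = y" if "{x, y} \<in> P" for x y
  proof -
    have "{x, f x} = {x, y}"
      using disj[of "{x, f x}" "{x, y}" x] f[of x] that by blast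
    then show ?thesis by (auto simp: doubleton_eq_iff)
  qed
  have f_inv: "f x \<in> \<Union>P" "f x \<noteq> x" "f (f x) = x" if x: "x \<in> \<Union>P" for x
    using f[OF x] f_unique[of "f x" x] P(2)[OF f[OF x]] by (auto simp: insert_commute)
  have UP: "\<Union>P \<subseteq> {1..k}"
    using P(1) by blast
  have "card (\<Union>P) = sum card P"
  proof (rule card_Union_disjoint)
    show "pairwise disjnt P"
      using disj unfolding pairwise_def disjnt_def by blast
    show "finite p" if "p \<in> P" for p
      using P(1)[OF that] by (rule finite_subset) simp
  qed
  also have "\<dots> = 2 * card P"
    using P(2) by simp
  finally have evenP: "even (card (\<Union>P))" by simp
  define D where "D = (if even k then {1..k} else {0..k})"
  have D: "finite D" "even (card D)" "\<Union>P \<subseteq> D" "{1..k} \<subseteq> D" "D \<subseteq> {0..k}"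
    using UP by (auto simp: D_def)
  have "even (card (D - \<Union>P))"
    using D evenP by (subst card_Diff_subset) (auto intro: finite_subset)
  with D(1) obtain g where g: "\<And>x. x \<in> D - \<Union>P \<Longrightarrow> g x \<in> D - \<Union>P \<and> g x \<noteq> x \<and> g (g x) = x"
    using even_card_involution[of "D - \<Union>P"] by blast
  define e where "e x = (if x \<in> \<Union>P then f x else if x \<in> D then g x else x)" for x
  have eP: "e x = f x" if "x \<in> \<Union>P" for x
    using that by (simp add: e_def)
  have eD: "e x = g x" if "x \<in> D - \<Union>P" for x
    using that by (auto simp: e_def)
  have eN: "e x = x" if "x \<notin> D" for x
    using that D(3) by (auto simp: e_def)
  have inD: "e x \<in> D \<and> e x \<noteq> x \<and> e (e x) = x" if "x \<in> D" for x
  proof (cases "x \<in> \<Union>P")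
    case True
    then show ?thesis
      using f_inv[of x] eP[of x] eP[of "f x"] D(3) by auto
  next
    case False
    then show ?thesis
      using that g[of x] eD[of x] eD[of "g x"] by auto
  qed
  show ?thesis
  proof
    show "e x \<le> k \<and> e (e x) = x" if "x \<le> k" for x
      using inD[of x] eN[of x] D(5) that by (cases "x \<in> D") auto
    show "e x \<noteq> x" if "x \<in> {1..k}" for x
      using inD[of x] D(4) that by auto
    show "\<exists>x \<in> {1..k}. e x \<in> {1..k} \<and> p = {x, e x}" if p: "p \<in> P" for p
    proof -
      obtain x y where xy: "p = {x, y}"
        using P(2)[OF p] by (auto simp: card_2_iff)
      then have "e x = y"
        using p f_unique[of x y] eP[of x] by auto
      then show ?thesis
        using xy P(1)[OF p] by auto
    qed
  qed
qed

lemma claimed_Nil [simp]: "claimed t p [] = {}"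
  by (simp add: claimed_def)

lemma claimed_snoc:
  "claimed t p (h @ [x]) = claimed t p h \<union> (if mover t (length h) = p then {x} else {})"
proof -
  have image: "claimed t p g = (!) g ` {i. i < length g \<and> mover t i = p}" for g
    by (auto simp: claimed_def)
  have "{i. i < length (h @ [x]) \<and> mover t i = p} =
      {i. i < length h \<and> mover t i = p} \<union> (if mover t (length h) = p then {length h} else {})"
    by (auto simp: less_Suc_eq)
  then show ?thesis
    unfolding image by (auto simp: nth_append image_iff)
qed

lemma opponent_simps [simp]: "opponent (opponent p) = p" "opponent p \<noteq> p" "p \<noteq> opponent p"
  by (cases p; simp)+

lemma not_player_iff: "q \<noteq> p \<longleftrightarrow> q = opponent p"
  by (cases p; cases q; simp)

lemma mover_Suc: "mover t (Suc i) = opponent (mover t i)"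
  by (simp add: mover_def)

lemma claimed_Un: "claimed t p h \<union> claimed t (opponent p) h = set h"
  by (induction h rule: rev_induct) (auto simp: claimed_snoc not_player_iff)

lemma claimed_Int: "distinct h \<Longrightarrow> claimed t p h \<inter> claimed t (opponent p) h = {}"
proof (induction h rule: rev_induct)
  case (snoc x h)
  then show ?case
    using claimed_Un[of t p h] by (auto simp: claimed_snoc)
qed simp

text \<open>
  Below, \<open>M\<close> holds the elements claimed by the player who owns the involution \<open>e\<close>, and
  \<open>N\<close> those claimed by the opponent. An unclaimed element is loose if answering it with its
  partner is impossible.
\<close>

definition loose :: "(nat \<Rightarrow> nat) \<Rightarrow> nat set \<Rightarrow> nat set" where
  "loose e U = {x \<in> U. e x \<notin> U}"

text \<open>
  The invariant when the opponent is to move. One loose element has to be tolerated: the owner may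
  have had to open a pair when there was nothing to answer. A second one could not be tolerated: once the
  opponent takes one of the two, the other may be all that is left to the owner, who already holds its partner.
\<close>

definition settled :: "nat \<Rightarrow> (nat \<Rightarrow> nat) \<Rightarrow> nat set \<Rightarrow> nat set \<Rightarrow> bool" where
  "settled k e M N \<longleftrightarrow>
     (\<forall>x \<in> N. e x \<in> {1..k} \<longrightarrow> e x \<in> M) \<and> (\<forall>x \<in> M. e x \<notin> M) \<and>
     (\<forall>x \<in> loose e ({1..k} - (M \<union> N)). \<forall>y \<in> loose e ({1..k} - (M \<union> N)). x = y)"

text \<open>
  The invariant when the owner is to move and \<open>u\<close> is the element just claimed by the opponent, or
  the dummy \<open>0\<close> if the owner opens the game. Either \<open>u\<close> calls for the answer
  \<open>e u\<close>, or no answer is due and only untouched pairs are left.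
\<close>

definition challenged :: "nat \<Rightarrow> (nat \<Rightarrow> nat) \<Rightarrow> nat \<Rightarrow> nat set \<Rightarrow> nat set \<Rightarrow> bool" where
  "challenged k e u M N \<longleftrightarrow>
     (let U = {1..k} - (M \<union> N) in
     (\<forall>x \<in> N. e x \<in> {1..k} \<longrightarrow> e x \<in> M \<or> x = u \<and> e x \<in> U) \<and> (\<forall>x \<in> M. e x \<notin> M) \<and>
     (if e u \<in> U then \<forall>x \<in> loose e U - {e u}. \<forall>y \<in> loose e U - {e u}. x = y
      else loose e U = {}))"

context
  fixes k :: nat and e :: "nat \<Rightarrow> nat"
  assumes involution: "\<And>x. x \<le> k \<Longrightarrow> e x \<le> k \<and> e (e x) = x"
    and no_fixed_point: "\<And>x. x \<in> {1..k} \<Longrightarrow> e x \<noteq> x"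
begin

text \<open>
  Only the partner of the dummy can be loose on the empty board. If the owner moves second, it plays the role
  of an element whose partner the owner already holds; if the owner moves first, the dummy counts as the
  opponent's move and its partner is the answer.
\<close>

lemma settled_start: "settled k e {} {}"
proof -
  have "x = e 0" if "x \<in> loose e {1..k}" for x
    using that involution[of x] involution[of "e x"] by (cases "e x") (auto simp: loose_def)
  then show ?thesis
    by (auto simp: settled_def)
qed

lemma challenged_start: "challenged k e 0 {} {}"
proof -
  have "x = e 0" if "x \<in> loose e {1..k}" for x
    using that involution[of x] involution[of "e x"] by (cases "e x") (auto simp: loose_def)
  then have "loose e {1..k} \<subseteq> {e 0}"
    by blast
  moreover have "loose e {1..k} \<subseteq> {1..k}"
    by (auto simp: loose_def)
  ultimately show ?thesis
    unfolding challenged_def Let_def by (simp del: atLeastAtMost_iff) blast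
qed

text \<open>
  The opponent's move either breaks an untouched pair, making its other half the only new loose
  element, or takes the loose element and leaves none.
\<close>

lemma settled_imp_challenged:
  assumes S: "settled k e M N" and u: "u \<in> {1..k} - (M \<union> N)"
  shows "challenged k e u M (insert u N)"
proof -
  let ?U = "{1..k} - (M \<union> N)"
  have U: "{1..k} - (M \<union> insert u N) = ?U - {u}" by auto
  have e: "e (e x) = x" "e x \<noteq> x" if "x \<in> ?U" for x
    using involution no_fixed_point that by auto
  have unique: "x = y" if "x \<in> loose e ?U" "y \<in> loose e ?U" for x y
    using S that by (auto simp: settled_def)
  have loose: "x \<in> loose e ?U \<or> x = e u" if "x \<in> loose e (?U - {u})" for x
    using that e(1)[of x] by (auto simp: loose_def)
  have opp: "e u \<in> M \<or> e u \<in> ?U" if "e u \<in> {1..k}"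
    using S that u e(1)[of u] by (auto simp: settled_def)
  have "loose e (?U - {u}) = {}" if "e u \<notin> ?U"
  proof -
    have "u \<in> loose e ?U"
      using that u by (simp add: loose_def)
    moreover have "loose e (?U - {u}) \<subseteq> ?U - {u}"
      by (auto simp: loose_def)
    ultimately show ?thesis
      using unique loose that by blast
  qed
  moreover have "\<forall>x \<in> loose e (?U - {u}) - {e u}. \<forall>y \<in> loose e (?U - {u}) - {e u}. x = y"
    using unique loose by blast
  moreover have "e u \<in> ?U - {u} \<longleftrightarrow> e u \<in> ?U"
    using e(2)[OF u] by blast
  ultimately have "if e u \<in> ?U - {u}
      then \<forall>x \<in> loose e (?U - {u}) - {e u}. \<forall>y \<in> loose e (?U - {u}) - {e u}. x = y
      else loose e (?U - {u}) = {}"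
    by (simp only: split: if_split) blast
  moreover have "e x \<in> M \<or> x = u \<and> e x \<in> ?U - {u}" if "x \<in> insert u N" "e x \<in> {1..k}" for x
  proof (cases "x = u")
    case True
    then show ?thesis
      using opp e(2)[OF u] that(2) by simp
  next
    case False
    then show ?thesis
      using S that unfolding settled_def by blast
  qed
  moreover have "\<forall>x \<in> M. e x \<notin> M"
    using S unfolding settled_def by blast
  ultimately show ?thesis
    unfolding challenged_def U Let_def by blast
qed

text \<open>
  Answering with the partner closes the broken pair. If there is nothing to answer, no element is
  loose, so any move \<open>c\<close> opens an untouched pair and makes \<open>e c\<close> the only loose element.
\<close>

lemma challenged_imp_settled:
  assumes C: "challenged k e u M N" and u: "u \<le> k" "u \<notin> M" "u \<in> insert 0 N"
    and MN: "M \<union> N \<subseteq> {1..k}"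
    and c: "c \<in> {1..k} - (M \<union> N)" and reply: "e u \<in> {1..k} - (M \<union> N) \<Longrightarrow> c = e u"
  shows "settled k e (insert c M) N"
proof -
  let ?U = "{1..k} - (M \<union> N)"
  have U: "{1..k} - (insert c M \<union> N) = ?U - {c}" by auto
  have e: "e (e x) = x" "e x \<noteq> x" if "x \<in> {1..k}" for x
    using involution no_fixed_point that by auto
  have N: "e x \<in> M \<or> x = u \<and> e x \<in> ?U" if "x \<in> N" "e x \<in> {1..k}" for x
    using C that by (auto simp: challenged_def Let_def)
  have M: "e x \<notin> M" if "x \<in> M" for x
    using C that by (auto simp: challenged_def Let_def)
  have loose: "x \<in> loose e ?U \<or> x = e c" if "x \<in> loose e (?U - {c})" for x
    using that e(1)[of x] by (auto simp: loose_def)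
  have ec: "e c \<notin> M \<and> (\<forall>x \<in> loose e (?U - {c}). \<forall>y \<in> loose e (?U - {c}). x = y)"
  proof (cases "e u \<in> ?U")
    case True
    then have "c = e u" "e c = u"
      using reply involution[OF u(1)] by auto
    moreover have "u \<notin> ?U"
      using u by auto
    ultimately have "loose e (?U - {c}) \<subseteq> loose e ?U - {e u}"
      using loose by (auto simp: loose_def)
    with C True \<open>e c = u\<close> u(2) show ?thesis
      unfolding challenged_def Let_def by (simp only: if_True) blast
  next
    case False
    then have L: "loose e ?U = {}"
      using C by (simp add: challenged_def Let_def)
    then have "e c \<in> ?U"
      using c by (auto simp: loose_def)
    with L loose show ?thesis by blast
  qed
  have "e x \<noteq> c" if "x \<in> M" for x
  proof -
    have "e (e x) = x"
      using that MN by (intro e(1)) blast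
    with that ec show ?thesis by metis
  qed
  then have "\<forall>x \<in> insert c M. e x \<notin> insert c M"
    using M ec e(2)[of c] c by (metis DiffD1 insertE)
  moreover have "\<forall>x \<in> N. e x \<in> {1..k} \<longrightarrow> e x \<in> insert c M"
    using N reply by (metis insertCI)
  ultimately show ?thesis
    using ec unfolding settled_def U by blast
qed

text \<open>
  Putting the dummy \<open>0\<close> in front of the history makes the opening move an answer to the dummy.
\<close>

definition reply_strategy :: "nat list \<Rightarrow> nat" where
  "reply_strategy h =
     (let y = e (last (0 # h)) in
      if y \<in> {1..k} - set h then y else SOME x. x \<in> {1..k} - set h)"

lemma strategy_reply: "strategy k t p reply_strategy"
proof -
  have "(SOME x. x \<in> {1..k} - set h) \<in> {1..k} - set h" if "position k h" "length h < k" for h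
  proof (rule someI_ex)
    have "card (set h) < card {1..k}"
      using that by (simp add: position_def distinct_card)
    then show "\<exists>x. x \<in> {1..k} - set h"
      using card_mono[of "set h" "{1..k}"] by fastforce
  qed
  then show ?thesis
    unfolding strategy_def reply_strategy_def Let_def by (auto split: if_splits)
qed

lemma reply_invariant:
  assumes "position k h" "follows t p reply_strategy h"
  shows "if mover t (length h) = p
         then challenged k e (last (0 # h)) (claimed t p h) (claimed t (opponent p) h)
         else settled k e (claimed t p h) (claimed t (opponent p) h)"
  using assms
proof (induction h rule: rev_induct)
  case Nil
  then show ?case
    using settled_start challenged_start by simp
next
  case (snoc c h)
  have c: "c \<in> {1..k} - set h" and pos: "position k h"
    using snoc.prems(1) by (auto simp: position_def)
  have fol: "follows t p reply_strategy h"
    using snoc.prems(2) unfolding follows_def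
    by (metis (no_types, lifting) butlast_snoc length_append_singleton less_Suc_eq nth_butlast
        take_butlast)
  note IH = snoc.IH[OF pos fol]
  note Un = claimed_Un[of t p h]
  show ?case
  proof (cases "mover t (length h) = p")
    case True
    have sg: "c = reply_strategy h"
      using snoc.prems(2) True unfolding follows_def
      by (metis append_eq_conv_conj length_append_singleton lessI nth_append_length)
    let ?u = "last (0 # h)"
    have u: "?u \<le> k" "?u \<in> insert 0 (claimed t (opponent p) h)"
    proof -
      show "?u \<le> k"
        using pos last_in_set[of h] by (cases "h = []") (auto simp: position_def subset_iff)
      show "?u \<in> insert 0 (claimed t (opponent p) h)"
      proof (cases h rule: rev_exhaust)
        case (snoc g x)
        then have "mover t (length g) = opponent p"
          using True by (auto simp: mover_Suc)
        then show ?thesis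
          using snoc by (simp add: claimed_snoc)
      qed simp
    qed
    have "0 \<notin> set h"
      using pos by (auto simp: position_def)
    then have u': "?u \<notin> claimed t p h"
      using u(2) claimed_Int[of h t p] pos Un by (auto simp: position_def)
    have "settled k e (insert c (claimed t p h)) (claimed t (opponent p) h)"
    proof (rule challenged_imp_settled[OF _ u(1) u' u(2)])
      show "challenged k e ?u (claimed t p h) (claimed t (opponent p) h)"
        using IH True by simp
      show "claimed t p h \<union> claimed t (opponent p) h \<subseteq> {1..k}"
        unfolding Un using pos by (simp add: position_def)
      show "c \<in> {1..k} - (claimed t p h \<union> claimed t (opponent p) h)"
        unfolding Un by (rule c)
      show "c = e ?u" if "e ?u \<in> {1..k} - (claimed t p h \<union> claimed t (opponent p) h)"
        using that unfolding Un sg reply_strategy_def Let_def by simp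
    qed
    then show ?thesis
      using True by (simp add: mover_Suc claimed_snoc)
  next
    case False
    then have opp: "mover t (length h) = opponent p"
      by (simp add: not_player_iff)
    have "challenged k e c (claimed t p h) (insert c (claimed t (opponent p) h))"
      by (rule settled_imp_challenged) (use IH False c Un in auto)
    then show ?thesis
      using opp False by (simp add: mover_Suc claimed_snoc)
  qed
qed

lemma reply_separates:
  assumes h: "complete_play k h" "follows t p reply_strategy h"
    and x: "x \<in> {1..k}" "e x \<in> {1..k}"
  shows "x \<in> claimed t p h \<longleftrightarrow> e x \<notin> claimed t p h"
proof -
  let ?M = "claimed t p h" and ?N = "claimed t (opponent p) h"
  have Un: "?M \<union> ?N = {1..k}"
    using h(1) claimed_Un[of t p h] by (simp add: complete_play_def)
  have "position k h"
    using h(1) by (simp add: position_def complete_play_def)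
  from reply_invariant[OF this h(2)]
  have "(\<forall>x \<in> ?N. e x \<in> {1..k} \<longrightarrow> e x \<in> ?M) \<and> (\<forall>x \<in> ?M. e x \<notin> ?M)"
    unfolding challenged_def settled_def Let_def Un by (auto split: if_splits)
  then show ?thesis
    using x Un by blast
qed

end

text \<open>
  The owner of the pairing ends up with exactly one element of each pair, hence so does the opponent. So
  whoever owns it, the set claimed by Split is a splitter of the pairs. This is why the first mover does
  not matter.
\<close>

lemma pairing_strategy_imp_winning_strategy:
  assumes "has_pairing_strategy k n B p"
  shows "has_winning_strategy k n B t p"
proof -
  obtain P where P: "pairing k P"
    and win: "\<And>A. splitter k P A \<Longrightarrow>
      (case p of Split \<Rightarrow> splits_family A n B | Skew \<Rightarrow> \<not> splits_family A n B)"
    using assms by (auto simp: has_pairing_strategy_def)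
  obtain e where e: "\<And>x. x \<le> k \<Longrightarrow> e x \<le> k \<and> e (e x) = x"
      "\<And>x. x \<in> {1..k} \<Longrightarrow> e x \<noteq> x"
    and eP: "\<And>q. q \<in> P \<Longrightarrow> \<exists>x \<in> {1..k}. e x \<in> {1..k} \<and> q = {x, e x}"
    using pairing_extends_to_involution[OF P] by blast
  let ?\<sigma> = "reply_strategy k e"
  have "wins_play n B t p h" if h: "complete_play k h" "follows t p ?\<sigma> h" for h
  proof -
    let ?A = "claimed t Split h"
    have "distinct h" "set h = {1..k}"
      using h(1) by (auto simp: complete_play_def)
    then have compl: "x \<in> ?A \<longleftrightarrow> x \<notin> claimed t Skew h" if "x \<in> {1..k}" for x
      using claimed_Un[of t Split h] claimed_Int[of h t Split] that by auto
    have sep: "x \<in> ?A \<longleftrightarrow> e x \<notin> ?A" if "x \<in> {1..k}" "e x \<in> {1..k}" for x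
      using reply_separates[OF e h that] compl that by (cases p) auto
    have "card (?A \<inter> q) = 1" if "q \<in> P" for q
    proof -
      obtain x where x: "x \<in> {1..k}" "e x \<in> {1..k}" "q = {x, e x}"
        using eP[OF \<open>q \<in> P\<close>] by blast
      have "?A \<inter> q = (if x \<in> ?A then {x} else {e x})"
        using sep[OF x(1,2)] x(3) by auto
      then show ?thesis by simp
    qed
    moreover have "?A \<subseteq> {1..k}"
      using claimed_Un[of t Split h] \<open>set h = {1..k}\<close> by auto
    ultimately have "splitter k P ?A"
      by (simp add: splitter_def)
    from win[OF this] show ?thesis
      by (simp add: wins_play_def)
  qed
  then show ?thesis
    using strategy_reply[OF e] unfolding has_winning_strategy_def by blast
qed

section \<open>Uniqueness of the winner\<close>

primrec play :: "(nat \<Rightarrow> nat list \<Rightarrow> nat) \<Rightarrow> nat \<Rightarrow> nat list" where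
  "play \<sigma> 0 = []"
| "play \<sigma> (Suc i) = play \<sigma> i @ [\<sigma> i (play \<sigma> i)]"

lemma length_play [simp]: "length (play \<sigma> i) = i"
  by (induction i) auto

lemma take_play: "i \<le> j \<Longrightarrow> take i (play \<sigma> j) = play \<sigma> i"
  by (induction j) (auto simp: le_Suc_eq)

lemma nth_play: "i < j \<Longrightarrow> play \<sigma> j ! i = \<sigma> i (play \<sigma> i)"
  by (induction j) (auto simp: nth_append less_Suc_eq)

text \<open>
  Two winning strategies played against each other would produce a play won by both players.
\<close>

lemma at_most_one_winner:
  assumes "has_winning_strategy k n B t Split" "has_winning_strategy k n B t Skew"
  shows False
proof -
  obtain \<sigma> where \<sigma>: "strategy k t Split \<sigma>"
      "\<And>h. complete_play k h \<Longrightarrow> follows t Split \<sigma> h \<Longrightarrow> wins_play n B t Split h"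
    using assms(1) by (auto simp: has_winning_strategy_def)
  obtain \<tau> where \<tau>: "strategy k t Skew \<tau>"
      "\<And>h. complete_play k h \<Longrightarrow> follows t Skew \<tau> h \<Longrightarrow> wins_play n B t Skew h"
    using assms(2) by (auto simp: has_winning_strategy_def)
  define pl where "pl = play (\<lambda>i. case mover t i of Split \<Rightarrow> \<sigma> | Skew \<Rightarrow> \<tau>)"
  have legal: "position k (pl i)" if "i \<le> k" for i
    using that
  proof (induction i)
    case 0
    then show ?case by (simp add: pl_def position_def)
  next
    case (Suc i)
    then have "(case mover t i of Split \<Rightarrow> \<sigma> | Skew \<Rightarrow> \<tau>) (pl i) \<in> {1..k} - set (pl i)"
      using \<sigma>(1) \<tau>(1) by (auto simp: strategy_def pl_def split: player.split)
    then show ?case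
      using Suc by (auto simp: pl_def position_def)
  qed
  have "card (set (pl k)) = k"
    using legal[of k] by (simp add: position_def distinct_card pl_def)
  then have "complete_play k (pl k)"
    using legal[of k] card_subset_eq[of "{1..k}" "set (pl k)"]
    by (simp add: position_def complete_play_def)
  moreover have "follows t Split \<sigma> (pl k)" "follows t Skew \<tau> (pl k)"
    by (auto simp: follows_def pl_def nth_play take_play)
  ultimately show False
    using \<sigma>(2)[of "pl k"] \<tau>(2)[of "pl k"] by (simp add: wins_play_def)
qed

section \<open>Reduction to one element per odd Venn region\<close>

text \<open>
  A list of pairs \<open>(I, J)\<close> of index sets describes a matching of the odd Venn regions: \<open>I\<close> is
  matched with \<open>J\<close>, and \<open>(I, {})\<close> says that \<open>I\<close> stays unmatched. The empty set is a
  convenient stand-in because it contributes nothing to any offset.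
\<close>

definition listed :: "(nat set \<times> nat set) list \<Rightarrow> nat set list" where
  "listed M = filter (\<lambda>I. I \<noteq> {}) (concat (map (\<lambda>(I, J). [I, J]) M))"

text \<open>
  The offset of \<open>(I, J)\<close> is the amount by which the \<open>i\<close>-th set gains for Split when
  Split takes the representative of \<open>I\<close> and Skew that of \<open>J\<close>; it changes sign if they swap.
\<close>

definition offset :: "nat set \<times> nat set \<Rightarrow> nat \<Rightarrow> int" where
  "offset p i = of_bool (i \<in> fst p) - of_bool (i \<in> snd p)"

text \<open>
  All vectors of differences (elements of the \<open>i\<close>-th set taken by Split minus those taken by Skew)
  that can arise once the matching is respected.
\<close>

fun signed_sums :: "(nat set \<times> nat set) list \<Rightarrow> (nat \<Rightarrow> int) list" where
  "signed_sums [] = [\<lambda>_. 0]"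
| "signed_sums (p # M) =
     map (\<lambda>d i. d i + offset p i) (signed_sums M) @
     map (\<lambda>d i. d i - offset p i) (signed_sums M)"

definition region_pairing :: "(nat set \<times> nat set) list \<Rightarrow> nat set set \<Rightarrow> bool" where
  "region_pairing M C \<longleftrightarrow> (\<forall>p \<in> set M. fst p \<noteq> {}) \<and> distinct (listed M) \<and> set (listed M) = C"

definition favours :: "nat \<Rightarrow> player \<Rightarrow> (nat \<Rightarrow> int) \<Rightarrow> bool" where
  "favours n p d \<longleftrightarrow> (p = Split) = (\<forall>i \<in> {1..n}. \<bar>d i\<bar> \<le> 1)"

definition side :: "nat set \<Rightarrow> nat \<Rightarrow> int" where
  "side A x = (if x \<in> A then 1 else - 1)"

lemma sum_side: "finite X \<Longrightarrow> sum (side A) X = 2 * int (card (A \<inter> X)) - int (card X)"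
proof (induction X rule: finite_induct)
  case (insert x X)
  then show ?case
    by (auto simp: side_def Int_insert_right)
qed simp

lemma splits_iff_sum_side:
  assumes "finite X"
  shows "splits A X \<longleftrightarrow> \<bar>sum (side A) X\<bar> \<le> 1"
proof -
  have "odd c \<Longrightarrow> a \<in> {(c - 1) div 2, (c + 1) div 2} \<longleftrightarrow> \<bar>2 * int a - int c\<bar> \<le> 1"
    and "even c \<Longrightarrow> a = c div 2 \<longleftrightarrow> \<bar>2 * int a - int c\<bar> \<le> 1" for a c :: nat
    by (auto elim!: evenE oddE)
  then show ?thesis
    unfolding splits_def sum_side[OF assms] by simp
qed

lemma signed_sums_signs:
  assumes "\<And>p. p \<in> set M \<Longrightarrow> \<epsilon> p \<in> {1, - 1}"
  shows "(\<lambda>i. \<Sum>p\<leftarrow>M. \<epsilon> p * offset p i) \<in> set (signed_sums M)"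
  using assms
proof (induction M)
  case (Cons p M)
  let ?d = "\<lambda>i. \<Sum>p\<leftarrow>M. \<epsilon> p * offset p i"
  have "?d \<in> set (signed_sums M)"
    using Cons by simp
  moreover have "(\<lambda>i. \<Sum>p\<leftarrow>p # M. \<epsilon> p * offset p i) \<in> {\<lambda>i. ?d i + offset p i, \<lambda>i. ?d i - offset p i}"
    using Cons.prems[of p] by auto
  ultimately show ?case
    by auto
qed simp

lemma listed_Cons: "listed ((I, J) # M) =
    (if I = {} then [] else [I]) @ (if J = {} then [] else [J]) @ listed M"
  by (simp add: listed_def)

text \<open>
  Matched representatives are on opposite sides, so each pair contributes a single sign times its offset.
\<close>

lemma sum_listed:
  assumes "\<forall>(I, J) \<in> set M. I \<noteq> {} \<and> (J \<noteq> {} \<longrightarrow> s J = - s I)"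
  shows "(\<Sum>I\<leftarrow>listed M. of_bool (i \<in> I) * s I) = (\<Sum>(I, J)\<leftarrow>M. s I * offset (I, J) i)"
  using assms
proof (induction M)
  case (Cons p M)
  then show ?case
    by (cases p) (auto simp: listed_Cons offset_def algebra_simps)
qed (simp add: listed_def)

definition proper_pairs :: "(nat set \<times> nat set) list \<Rightarrow> nat set set set" where
  "proper_pairs M = {{I, J} | I J. (I, J) \<in> set M \<and> J \<noteq> {}}"

lemma proper_pairs_matching:
  assumes "\<forall>p \<in> set M. fst p \<noteq> {}" "distinct (listed M)"
  shows "disjoint (proper_pairs M) \<and> (\<forall>q \<in> proper_pairs M. q \<subseteq> set (listed M) \<and> card q = 2)"
  using assms
proof (induction M)
  case (Cons m M)
  obtain I J where m: "m = (I, J)"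
    by (cases m)
  have IH: "disjoint (proper_pairs M)" "\<And>q. q \<in> proper_pairs M \<Longrightarrow> q \<subseteq> set (listed M) \<and> card q = 2"
    using Cons by (auto simp: m listed_Cons)
  have step: "proper_pairs (m # M) = (if J = {} then {} else {{I, J}}) \<union> proper_pairs M"
    by (auto simp: proper_pairs_def m)
  show ?case
  proof (cases "J = {}")
    case True
    then have "proper_pairs (m # M) = proper_pairs M"
      by (simp add: step)
    moreover have "set (listed M) \<subseteq> set (listed (m # M))"
      by (auto simp: m listed_Cons)
    ultimately show ?thesis
      using IH by auto
  next
    case False
    have new: "I \<noteq> J" "I \<notin> set (listed M)" "J \<notin> set (listed M)" "I \<noteq> {}"
      using Cons.prems False by (auto simp: m listed_Cons)
    have "disjoint (proper_pairs (m # M))"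
      unfolding step
    proof (rule disjoint_union)
      have "\<Union>(proper_pairs M) \<subseteq> set (listed M)"
        using IH(2) by blast
      then show "\<Union>(if J = {} then {} else {{I, J}}) \<inter> \<Union>(proper_pairs M) = {}"
        using new by auto
    qed (use IH(1) in simp_all)
    moreover have "q \<subseteq> set (listed (m # M)) \<and> card q = 2" if "q \<in> proper_pairs (m # M)" for q
    proof -
      have "q = {I, J} \<or> q \<in> proper_pairs M"
        using that unfolding step by (auto split: if_splits)
      moreover have "{I, J} \<union> set (listed M) = set (listed (m # M))"
        using new False by (auto simp: m listed_Cons)
      moreover have "card {I, J} = 2"
        using new(1) by (metis card_2_iff)
      ultimately show ?thesis
        using IH(2)[of q] by (metis Un_upper1 Un_upper2 order_trans)
    qed
    ultimately show ?thesis by blast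
  qed
qed (simp add: proper_pairs_def)

text \<open>
  Matching the elements of one region removes its influence up to at most one representative
  \<open>r\<close>: partners lie in the same members of the family, so their sides cancel.
\<close>

lemma matching_in_region:
  assumes "finite V" and "odd (card V) \<Longrightarrow> r \<in> V"
  obtains Q where "\<And>q. q \<in> Q \<Longrightarrow> q \<subseteq> V - (if odd (card V) then {r} else {}) \<and> card q = 2"
    and "disjoint Q"
    and "\<And>A. (\<And>q. q \<in> Q \<Longrightarrow> card (A \<inter> q) = 1) \<Longrightarrow>
           sum (side A) V = (if odd (card V) then side A r else 0)"
proof -
  let ?R = "if odd (card V) then {r} else {}"
  let ?W = "V - ?R"
  have "even (card ?W)" "finite ?W"
    using assms by (auto simp: card_Diff_singleton_if)
  then obtain e where e: "\<And>x. x \<in> ?W \<Longrightarrow> e x \<in> ?W \<and> e x \<noteq> x \<and> e (e x) = x"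
    using even_card_involution by blast
  show ?thesis
  proof
    show "q \<subseteq> ?W \<and> card q = 2" if q: "q \<in> (\<lambda>x. {x, e x}) ` ?W" for q
    proof -
      obtain x where x: "x \<in> ?W" "q = {x, e x}"
        using q by blast
      with e[OF x(1)] have "q \<subseteq> ?W" "e x \<noteq> x"
        by blast+
      then show ?thesis
        using x(2) by simp
    qed
    show "disjoint ((\<lambda>x. {x, e x}) ` ?W)"
    proof (rule disjointI)
      have recover: "p = {z, e z}" if "p \<in> (\<lambda>x. {x, e x}) ` ?W" "z \<in> p" for p z
      proof -
        obtain x where "x \<in> ?W" "p = {x, e x}"
          using \<open>p \<in> (\<lambda>x. {x, e x}) ` ?W\<close> by blast
        moreover from this have "z = x \<or> z = e x" "e (e x) = x"
          using \<open>z \<in> p\<close> e by blast+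
        ultimately show ?thesis
          by (metis insert_commute)
      qed
      fix p q
      assume "p \<in> (\<lambda>x. {x, e x}) ` ?W" "q \<in> (\<lambda>x. {x, e x}) ` ?W" "p \<noteq> q"
      with recover show "p \<inter> q = {}"
        by (metis disjoint_iff)
    qed
    show "sum (side A) V = (if odd (card V) then side A r else 0)"
      if A: "\<And>q. q \<in> (\<lambda>x. {x, e x}) ` ?W \<Longrightarrow> card (A \<inter> q) = 1" for A
    proof -
      have opp: "side A (e x) = - side A x" if "x \<in> ?W" for x
      proof -
        have "card (A \<inter> {x, e x}) = 1" "e x \<noteq> x"
          using A e that by blast+
        then show ?thesis
          by (auto simp: side_def card_1_singleton_iff Int_insert_right split: if_splits)
      qed
      have "bij_betw e ?W ?W"
        by (rule bij_betw_byWitness[where f' = e]) (use e in blast)+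
      then have "sum (side A) ?W = (\<Sum>x\<in>?W. side A (e x))"
        by (rule sum.reindex_bij_betw[symmetric])
      also have "\<dots> = - sum (side A) ?W"
        using opp by (simp add: sum_negf)
      finally have "sum (side A) ?W = 0"
        by simp
      then show ?thesis
        using assms by (auto simp: sum_diff1 split: if_splits)
    qed
  qed
qed

lemma venn_regions_disjoint:
  assumes "I \<subseteq> {1..n}" "J \<subseteq> {1..n}" "x \<in> venn_region k n B I" "x \<in> venn_region k n B J"
  shows "I = J"
  using assms unfolding venn_region_def by blast

lemma sum_over_venn_regions:
  assumes "game_board k n B" "i \<in> {1..n}"
  shows "sum f (B i) = (\<Sum>I | I \<subseteq> {1..n} \<and> i \<in> I. sum f (venn_region k n B I))"
proof -
  have "B i \<subseteq> {1..k}"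
    using assms by (auto simp: game_board_def)
  have "B i \<subseteq> (\<Union>I \<in> {I. I \<subseteq> {1..n} \<and> i \<in> I}. venn_region k n B I)"
  proof
    fix x assume "x \<in> B i"
    then have "x \<in> venn_region k n B {j \<in> {1..n}. x \<in> B j}"
      using \<open>B i \<subseteq> {1..k}\<close> unfolding venn_region_def by blast
    then show "x \<in> (\<Union>I \<in> {I. I \<subseteq> {1..n} \<and> i \<in> I}. venn_region k n B I)"
      by (rule UN_I[rotated]) (use assms(2) \<open>x \<in> B i\<close> in auto)
  qed
  moreover have "venn_region k n B I \<subseteq> B i" if "i \<in> I" for I
    using that by (auto simp: venn_region_def)
  ultimately have "B i = (\<Union>I \<in> {I. I \<subseteq> {1..n} \<and> i \<in> I}. venn_region k n B I)"
    by blast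
  also have "sum f \<dots> = (\<Sum>I | I \<subseteq> {1..n} \<and> i \<in> I. sum f (venn_region k n B I))"
  proof (rule sum.UNION_disjoint)
    show "\<forall>I \<in> {I. I \<subseteq> {1..n} \<and> i \<in> I}. \<forall>J \<in> {I. I \<subseteq> {1..n} \<and> i \<in> I}.
        I \<noteq> J \<longrightarrow> venn_region k n B I \<inter> venn_region k n B J = {}"
      using venn_regions_disjoint by blast
  qed (auto simp: venn_region_def)
  finally show ?thesis .
qed

text \<open>
  The reduction to one element per odd region. The actual pairing consists of the matchings inside
  the regions and of the pairs of representatives prescribed by \<open>M\<close>. For a splitter of it, the
  difference on \<open>B i\<close> is a sum over the odd regions containing \<open>i\<close>, which regroups along
  \<open>M\<close> into one of the signed sums.
\<close>

lemma region_pairing_imp_pairing_strategy: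
  assumes board: "game_board k n B" and M: "region_pairing M (odd_regions k n B)"
    and win: "\<And>d. d \<in> set (signed_sums M) \<Longrightarrow> favours n p d"
  shows "has_pairing_strategy k n B p"
proof -
  let ?V = "venn_region k n B" and ?C = "odd_regions k n B"
  have fin: "finite (?V I)" for I
    by (simp add: venn_region_def)
  have C: "I \<noteq> {}" "I \<subseteq> {1..n}" "odd (card (?V I))" if "I \<in> ?C" for I
    using that by (auto simp: odd_regions_def)
  define r where "r I = (SOME x. x \<in> ?V I)" for I
  have r: "r I \<in> ?V I" if "odd (card (?V I))" for I
  proof -
    have "?V I \<noteq> {}"
      using that by auto
    then show ?thesis
      unfolding r_def by (simp add: some_in_eq)
  qed
  have r_inj: "I = J" if "r I = r J" "I \<in> ?C" "J \<in> ?C" for I J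
    using venn_regions_disjoint[of I n J "r I"] r[of I] r[of J] C[OF that(2)] C[OF that(3)] that(1)
    by metis
  have "\<forall>I. \<exists>Q. (\<forall>q \<in> Q. q \<subseteq> ?V I - (if odd (card (?V I)) then {r I} else {}) \<and> card q = 2) \<and>
      disjoint Q \<and> (\<forall>A. (\<forall>q \<in> Q. card (A \<inter> q) = 1) \<longrightarrow>
         sum (side A) (?V I) = (if odd (card (?V I)) then side A (r I) else 0))"
    using matching_in_region[OF fin r] by metis
  then obtain Q where
        Q: "\<And>I q. q \<in> Q I \<Longrightarrow> q \<subseteq> ?V I - (if odd (card (?V I)) then {r I} else {}) \<and> card q = 2"
    and Q_disjoint: "\<And>I. disjoint (Q I)"
    and Q_sum: "\<And>I A. (\<And>q. q \<in> Q I \<Longrightarrow> card (A \<inter> q) = 1) \<Longrightarrow>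
           sum (side A) (?V I) = (if odd (card (?V I)) then side A (r I) else 0)"
    by metis
  \<comment> \<open>\<open>P1\<close> cancels everything but the representatives; \<open>P2\<close> realizes \<open>M\<close> on these.\<close>
  define P1 where "P1 = (\<Union>I \<in> Pow {1..n}. Q I)"
  define P2 where "P2 = (`) r ` proper_pairs M"
  have Mne: "I \<noteq> {}" if "(I, J) \<in> set M" for I J
    using M that by (force simp: region_pairing_def)
  have listed_set: "set (listed M) = ?C" and listed_distinct: "distinct (listed M)"
    using M by (auto simp: region_pairing_def)
  have inC: "I \<in> ?C" "J \<noteq> {} \<Longrightarrow> J \<in> ?C" if "(I, J) \<in> set M" for I J
    using that Mne[OF that] unfolding listed_set[symmetric] by (force simp: listed_def)+
  have r_inj_on: "inj_on r ?C"
    using r_inj by (auto intro: inj_onI)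
  have proper: "q \<subseteq> ?C" "card q = 2" if "q \<in> proper_pairs M" for q
    using proper_pairs_matching[of M] M that by (auto simp: region_pairing_def)
  have "disjoint (proper_pairs M)"
    using proper_pairs_matching[of M] M by (auto simp: region_pairing_def)
  moreover have "inj_on r (\<Union>(proper_pairs M))"
    using proper(1) by (intro inj_on_subset[OF r_inj_on]) blast
  ultimately have "disjoint P2"
    unfolding P2_def by (intro disjoint_image)
  moreover have "disjoint P1"
  proof (rule disjointI)
    fix q q' assume "q \<in> P1" "q' \<in> P1" "q \<noteq> q'"
    then obtain I I' where I: "I \<subseteq> {1..n}" "q \<in> Q I" "I' \<subseteq> {1..n}" "q' \<in> Q I'"
      by (auto simp: P1_def)
    show "q \<inter> q' = {}"
    proof (cases "I = I'")
      case True
      then show ?thesis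
        using Q_disjoint[of I] I \<open>q \<noteq> q'\<close> by (auto simp: disjoint_def)
    next
      case False
      then show ?thesis
        using Q[OF I(2)] Q[OF I(4)] venn_regions_disjoint[OF I(1) I(3)] by blast
    qed
  qed
  moreover have "\<Union>P1 \<inter> \<Union>P2 = {}"
  proof -
    have False if q: "q \<in> P1" "x \<in> q" and q': "q' \<in> P2" "x \<in> q'" for q q' x
    proof -
      obtain I where I: "I \<subseteq> {1..n}" "q \<in> Q I"
        using q(1) by (auto simp: P1_def)
      obtain J where J: "J \<in> ?C" "x = r J"
        using q' proper(1) unfolding P2_def by blast
      have "x \<in> ?V I" "x \<in> ?V J"
        using Q[OF I(2)] q(2) J r C(3) by blast+
      then have "I = J"
        using venn_regions_disjoint[OF I(1) C(2)[OF J(1)]] by blast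
      then show False
        using Q[OF I(2)] q(2) J C(3)[OF J(1)] by auto
    qed
    then show ?thesis by blast
  qed
  ultimately have "disjoint (P1 \<union> P2)"
    by (intro disjoint_union)
  moreover have "q \<subseteq> {1..k} \<and> card q = 2" if "q \<in> P1" for q
  proof -
    obtain I where "q \<in> Q I"
      using \<open>q \<in> P1\<close> by (auto simp: P1_def)
    moreover have "?V I \<subseteq> {1..k}"
      by (auto simp: venn_region_def)
    ultimately show ?thesis
      using Q by blast
  qed
  moreover have "q \<subseteq> {1..k} \<and> card q = 2" if "q \<in> P2" for q
  proof -
    obtain q' where q': "q' \<in> proper_pairs M" "q = r ` q'"
      using \<open>q \<in> P2\<close> by (auto simp: P2_def)
    then have "card q = 2"
      using proper[OF q'(1)] card_image[OF inj_on_subset[OF r_inj_on]] by metis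
    moreover have "r I \<in> {1..k}" if "I \<in> ?C" for I
      using r[OF C(3)[OF that]] by (simp add: venn_region_def)
    ultimately show ?thesis
      using q' proper(1)[OF q'(1)] by blast
  qed
  ultimately have "pairing k (P1 \<union> P2)"
    unfolding pairing_def by blast
  moreover have "if p = Split then splits_family A n B else \<not> splits_family A n B"
    if A: "splitter k (P1 \<union> P2) A" for A
  proof -
    define d where "d = (\<lambda>i. \<Sum>p\<leftarrow>M. side A (r (fst p)) * offset p i)"
    have "d \<in> set (signed_sums M)"
      unfolding d_def by (rule signed_sums_signs) (simp add: side_def)
    moreover have "sum (side A) (B i) = d i" if i: "i \<in> {1..n}" for i
    proof -
      have "sum (side A) (B i) = (\<Sum>I | I \<subseteq> {1..n} \<and> i \<in> I. sum (side A) (?V I))"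
        by (rule sum_over_venn_regions[OF board i])
      also have "\<dots> = (\<Sum>I | I \<subseteq> {1..n} \<and> i \<in> I. if odd (card (?V I)) then side A (r I) else 0)"
      proof (rule sum.cong[OF refl])
        fix I assume "I \<in> {I. I \<subseteq> {1..n} \<and> i \<in> I}"
        then show "sum (side A) (?V I) = (if odd (card (?V I)) then side A (r I) else 0)"
          using A by (intro Q_sum) (auto simp: splitter_def P1_def)
      qed
      also have "\<dots> = (\<Sum>I \<in> ?C. of_bool (i \<in> I) * side A (r I))"
        by (rule sum.mono_neutral_cong) (auto simp: odd_regions_def)
      also have "\<dots> = (\<Sum>I\<leftarrow>listed M. of_bool (i \<in> I) * side A (r I))"
        unfolding listed_set[symmetric] by (rule sum.distinct_set_conv_list[OF listed_distinct])
      also have "\<dots> = (\<Sum>(I, J)\<leftarrow>M. side A (r I) * offset (I, J) i)"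
      proof (rule sum_listed, clarify, intro conjI impI)
        fix I J assume IJ: "(I, J) \<in> set M"
        show "I \<noteq> {}" by (rule Mne[OF IJ])
        assume J: "J \<noteq> {}"
        have IJ': "{I, J} \<in> proper_pairs M"
          using IJ J by (auto simp: proper_pairs_def)
        then have "r ` {I, J} \<in> P2"
          unfolding P2_def by (rule imageI)
        then have "card (A \<inter> r ` {I, J}) = 1"
          using A unfolding splitter_def by blast
        then have "card (A \<inter> {r I, r J}) = 1"
          by simp
        moreover have "r I \<noteq> r J"
          using r_inj[OF _ inC(1)[OF IJ] inC(2)[OF IJ J]] proper(2)[OF IJ'] by fastforce
        ultimately show "side A (r J) = - side A (r I)"
          by (auto simp: side_def card_1_singleton_iff Int_insert_right split: if_splits)
      qed
      also have "\<dots> = d i"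
        by (simp add: d_def case_prod_unfold)
      finally show ?thesis .
    qed
    moreover have "splits_family A n B \<longleftrightarrow> (\<forall>i \<in> {1..n}. \<bar>sum (side A) (B i)\<bar> \<le> 1)"
      unfolding splits_family_def
      using board unfolding game_board_def
      by (intro ball_cong refl splits_iff_sum_side) (meson finite_atLeastAtMost finite_subset)
    ultimately show ?thesis
      using win[of d] by (auto simp: favours_def)
  qed
  ultimately show ?thesis
    unfolding has_pairing_strategy_def by (cases p) auto
qed

text \<open>
  At most two odd regions can be matched by a single pair. Its offsets are at most 1 in absolute value,
  so Split wins.
\<close>

lemma few_odd_regions_pairing:
  assumes "finite C" "card C \<le> 2" "{} \<notin> C"
  obtains M where "region_pairing M C" "\<And>d. d \<in> set (signed_sums M) \<Longrightarrow> favours n Split d"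
proof -
  consider "C = {}" | I where "C = {I}" | I J where "C = {I, J}" "I \<noteq> J"
  proof -
    have "card C = 0 \<or> card C = 1 \<or> card C = 2"
      using assms(2) by linarith
    then show thesis
      using that assms(1) by (auto simp: card_1_singleton_iff card_2_iff)
  qed
  then obtain M where M: "region_pairing M C" "signed_sums M = [\<lambda>_. 0] \<or>
      (\<exists>p. signed_sums M = [\<lambda>i. 0 + offset p i, \<lambda>i. 0 - offset p i])"
  proof cases
    case 1
    then show ?thesis
      by (intro that[of "[]"]) (auto simp: region_pairing_def listed_def)
  next
    case (2 I)
    then show ?thesis
      using assms(3) by (intro that[of "[(I, {})]"]) (auto simp: region_pairing_def listed_def)
  next
    case (3 I J)
    then show ?thesis
      using assms(3) by (intro that[of "[(I, J)]"]) (auto simp: region_pairing_def listed_Cons listed_def)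
  qed
  moreover have "\<bar>offset p i\<bar> \<le> 1" for p i
    by (simp add: offset_def of_bool_def)
  ultimately have "favours n Split d" if "d \<in> set (signed_sums M)" for d
    using that by (auto simp: favours_def)
  with M(1) show ?thesis
    by (rule that)
qed

section \<open>Renaming the members of the family\<close>

text \<open>
  Renaming the members of the family leaves its splitters unchanged and permutes the odd regions. For three
  sets, this reduces every collection of more than two odd regions to a tabulated one.
\<close>

lemma venn_region_relabel:
  assumes "\<rho> permutes {1..n}"
  shows "venn_region k n (B \<circ> \<rho>) I = venn_region k n B (\<rho> ` I)"
proof -
  have "\<rho> ` ({1..n} - I) = {1..n} - \<rho> ` I"
    using permutes_inj[OF assms] permutes_image[OF assms] by (simp add: image_set_diff)
  then have "(\<forall>j \<in> {1..n} - \<rho> ` I. x \<notin> B j) \<longleftrightarrow> (\<forall>i \<in> {1..n} - I. x \<notin> B (\<rho> i))" for x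
    by (metis (no_types, lifting) image_iff)
  then show ?thesis
    by (simp add: venn_region_def)
qed

lemma odd_regions_relabel:
  assumes "\<pi> permutes {1..n}"
  shows "odd_regions k n (B \<circ> inv \<pi>) = (`) \<pi> ` odd_regions k n B"
proof -
  have inv: "inv \<pi> permutes {1..n}"
    using assms by (rule permutes_inv)
  have cancel: "\<pi> ` inv \<pi> ` I = I" "inv \<pi> ` \<pi> ` I = I" for I
    using permutes_inverses[OF assms] by (auto simp: image_image)
  have sub: "inv \<pi> ` I \<subseteq> {1..n} \<longleftrightarrow> I \<subseteq> {1..n}" for I
    using permutes_image[OF assms] permutes_image[OF inv] cancel[of I] by (metis image_mono)
  have "I \<in> odd_regions k n (B \<circ> inv \<pi>) \<longleftrightarrow> inv \<pi> ` I \<in> odd_regions k n B" for I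
    by (simp only: odd_regions_def mem_Collect_eq venn_region_relabel[OF inv] sub image_is_empty)
  moreover have "I \<in> (`) \<pi> ` odd_regions k n B \<longleftrightarrow> inv \<pi> ` I \<in> odd_regions k n B" for I
    using cancel by (metis imageE imageI)
  ultimately show ?thesis
    by blast
qed

lemma game_board_relabel:
  assumes "\<rho> permutes {1..n}"
  shows "game_board k n (B \<circ> \<rho>) \<longleftrightarrow> game_board k n B"
proof -
  have "(\<forall>i \<in> {1..n}. B (\<rho> i) \<subseteq> {1..k}) \<longleftrightarrow> (\<forall>i \<in> \<rho> ` {1..n}. B i \<subseteq> {1..k})"
    by blast
  then show ?thesis
    unfolding game_board_def permutes_image[OF assms] by simp
qed

lemma pairing_strategy_relabel:
  assumes "\<rho> permutes {1..n}"
  shows "has_pairing_strategy k n (B \<circ> \<rho>) p \<longleftrightarrow> has_pairing_strategy k n B p"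
proof -
  have "(\<forall>i \<in> {1..n}. splits A (B (\<rho> i))) \<longleftrightarrow> (\<forall>i \<in> \<rho> ` {1..n}. splits A (B i))" for A
    by blast
  then have "splits_family A n (B \<circ> \<rho>) \<longleftrightarrow> splits_family A n B" for A
    unfolding splits_family_def permutes_image[OF assms] by simp
  then show ?thesis
    unfolding has_pairing_strategy_def by (cases p) simp_all
qed

section \<open>Matchings for three sets\<close>

text \<open>
  For each of the ten collections, a matching with at most one nonzero offset at every index. Then no
  signed sum can exceed 1 in absolute value.
\<close>

definition split_table :: "(nat set \<times> nat set) list list" where
  "split_table =
    [[({1}, {}), ({2}, {}), ({3}, {})],
     [({1}, {1, 3}), ({2}, {})],
     [({1}, {}), ({1, 3}, {1, 2, 3})],
     [({1}, {}), ({1, 2}, {1, 3})],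
     [({1, 2}, {1, 3}), ({2, 3}, {1, 2, 3})],
     [({3}, {2, 3}), ({1, 2}, {1, 2, 3})],
     [({2}, {1, 2}), ({3}, {2, 3})],
     [({2}, {}), ({3}, {}), ({2, 3}, {1, 2, 3})],
     [({2}, {1, 2}), ({1, 3}, {1, 2, 3}), ({3}, {})],
     [({1}, {1, 2}), ({2}, {2, 3}), ({3}, {1, 3})]]"

text \<open>
  An index at which exactly two offsets are nonzero admits only the differences 0 and \<open>\<plusminus>2\<close>; so a
  set that splits the family must make them cancel, which fixes their relative sign. The matchings below turn this into a
  contradiction.

  \<^item> In the first twelve, the same two offsets meet at two indices, with equal signs at one and
    opposite signs at the other, so that they cannot cancel at both.
  \<^item> In the next four, cancelling at two indices fixes relative signs that make the
    difference at the third index at least 2 in absolute value.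
  \<^item> In the last four, cancelling at one index turns the differences at the other two into
    \<open>2 a + b\<close> and \<open>2 a - b\<close> with \<open>a, b \<in> {1, - 1}\<close>, up to sign; one of these is \<open>\<plusminus>3\<close>.
\<close>

definition skew_table :: "(nat set \<times> nat set) list list" where
  "skew_table =
    [[({1}, {2}), ({1, 2}, {})],
     [({1}, {2}), ({1, 2, 3}, {})],
     [({1}, {2, 3}), ({1, 2}, {})],
     [({1}, {2, 3}), ({1, 2, 3}, {})],
     [({1, 3}, {2, 3}), ({1, 2}, {})],
     [({1, 2}, {1, 3}), ({1, 2, 3}, {})],
     [({1}, {2}), ({1, 2}, {}), ({3}, {})],
     [({2}, {3}), ({1, 2, 3}, {}), ({1}, {})],
     [({2}, {1, 3}), ({2, 3}, {}), ({1}, {})],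
     [({2}, {1, 3}), ({1, 2, 3}, {}), ({1}, {})],
     [({1, 2}, {1, 3}), ({2, 3}, {}), ({1}, {})],
     [({1, 2}, {1, 3}), ({1, 2, 3}, {}), ({1}, {})],
     [({1}, {2}), ({3}, {1, 2}), ({1, 3}, {})],
     [({1}, {2}), ({1, 2}, {1, 3}), ({1, 2, 3}, {})],
     [({1}, {1, 2, 3}), ({2}, {1, 3}), ({1, 2}, {2, 3})],
     [({1}, {1, 2, 3}), ({3}, {1, 2}), ({1, 3}, {}), ({2}, {2, 3})],
     [({1}, {2}), ({3}, {1, 2}), ({1, 2, 3}, {})],
     [({1}, {2, 3}), ({2}, {1, 3}), ({1, 2}, {})],
     [({1}, {2, 3}), ({1, 2}, {1, 3}), ({1, 2, 3}, {})],
     [({1}, {1, 2, 3}), ({2}, {1, 3}), ({3}, {1, 2})]]"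

definition region_list :: "nat set list" where
  "region_list = [{1}, {2}, {3}, {1, 2}, {1, 3}, {2, 3}, {1, 2, 3}]"

lemma split_table_wins:
  "\<forall>M \<in> set split_table. \<forall>d \<in> set (signed_sums M). \<forall>i \<in> {1, 2, 3}. \<bar>d i\<bar> \<le> 1"
  by code_simp

lemma skew_table_wins:
  "\<forall>M \<in> set skew_table. \<forall>d \<in> set (signed_sums M). \<exists>i \<in> {1, 2, 3}. \<bar>d i\<bar> > 1"
  by code_simp

lemma table_pairings:
  "\<forall>M \<in> set (split_table @ skew_table).
     (\<forall>p \<in> set M. fst p \<noteq> {}) \<and> distinct (listed M) \<and> set (listed M) \<subseteq> set region_list"
  by code_simp

lemma split_table_collections:
  "{{{1}, {2}, {3}},
     {{1}, {2}, {1, 3}},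
     {{1}, {1, 3}, {1, 2, 3}},
     {{1}, {1, 2}, {1, 3}},
     {{1, 2}, {1, 3}, {2, 3}, {1, 2, 3}},
     {{3}, {2, 3}, {1, 2}, {1, 2, 3}},
     {{2}, {3}, {2, 3}, {1, 2}},
     {{2}, {3}, {2, 3}, {1, 2, 3}},
     {{2}, {3}, {1, 2}, {1, 3}, {1, 2, 3}},
     {{1}, {2}, {3}, {1, 2}, {1, 3}, {2, 3}}} =
    (\<lambda>M. set (listed M)) ` set split_table"
  by code_simp

definition membership :: "nat set set \<Rightarrow> bool list" where
  "membership C = map (\<lambda>I. I \<in> C) region_list"

text \<open>
  A permutation of the indices together with its effect on the positions in \<open>region_list\<close>, which lets
  permutations act on membership vectors.
\<close>

definition relabellings :: "((nat \<Rightarrow> nat) \<times> nat list) list" where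
  "relabellings =
    [(id, [0, 1, 2, 3, 4, 5, 6]),
     (transpose 1 2, [1, 0, 2, 3, 5, 4, 6]),
     (transpose 1 3, [2, 1, 0, 5, 4, 3, 6]),
     (transpose 2 3, [0, 2, 1, 4, 3, 5, 6]),
     (transpose 1 2 \<circ> transpose 2 3, [1, 2, 0, 5, 3, 4, 6]),
     (transpose 2 3 \<circ> transpose 1 2, [2, 0, 1, 4, 5, 3, 6])]"

lemma relabellings_permute:
  assumes "(\<rho>, q) \<in> set relabellings"
  shows "\<rho> permutes {1, 2, 3}"
  using assms unfolding relabellings_def
  by (auto intro!: permutes_swap_id permutes_compose permutes_id)

lemma relabellings_positions:
  "\<forall>(\<rho>, q) \<in> set relabellings. map ((`) \<rho>) region_list = map ((!) region_list) q"
  by code_simp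

text \<open>
  The finite part of the classification. Collections are handled as vectors of seven truth values,
  for which evaluation by rewriting is feasible.
\<close>

lemma tables_exhaustive:
  "\<forall>v \<in> set (List.n_lists 7 [True, False]). length (filter id v) \<le> 2 \<or>
     (\<exists>(\<rho>, q) \<in> set relabellings. map ((!) v) q \<in>
       set (map (\<lambda>M. membership (set (listed M))) (split_table @ skew_table)))"
  by code_simp

lemma set_region_list: "set region_list = Pow {1, 2, 3} - {{}}"
  by code_simp

lemma tables_up_to_relabelling:
  assumes C: "C \<subseteq> Pow {1, 2, 3} - {{}}" and many: "card C > 2"
  obtains \<pi> M where "\<pi> permutes {1, 2, 3}" "M \<in> set (split_table @ skew_table)"
    "(`) \<pi> ` C = set (listed M)"
proof -
  let ?v = "membership C"
  have "?v \<in> set (List.n_lists 7 [True, False])"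
    by (auto simp: set_n_lists membership_def region_list_def)
  moreover have "length (filter id ?v) = card C"
  proof -
    have "length (filter id ?v) = length (filter (\<lambda>I. I \<in> C) region_list)"
      by (simp add: membership_def filter_map comp_def)
    also have "\<dots> = card (set (filter (\<lambda>I. I \<in> C) region_list))"
    proof (rule distinct_card[symmetric, OF distinct_filter])
      show "distinct region_list" by code_simp
    qed
    also have "set (filter (\<lambda>I. I \<in> C) region_list) = C"
      using C by (auto simp: set_region_list)
    finally show ?thesis .
  qed
  ultimately obtain \<rho> q M where \<rho>: "(\<rho>, q) \<in> set relabellings"
      and M: "M \<in> set (split_table @ skew_table)" "map ((!) ?v) q = membership (set (listed M))"
    using tables_exhaustive many by fastforce
  have perm: "\<rho> permutes {1, 2, 3}"
    by (rule relabellings_permute[OF \<rho>])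
  have "map (\<lambda>I. \<rho> ` I \<in> C) region_list = map (\<lambda>J. J \<in> C) (map ((`) \<rho>) region_list)"
    by simp
  also have "\<dots> = map (\<lambda>J. J \<in> C) (map ((!) region_list) q)"
    using relabellings_positions \<rho> by fastforce
  also have "\<dots> = map ((!) ?v) q"
    using \<rho> by (auto simp: membership_def relabellings_def region_list_def)
  finally have mem: "\<rho> ` I \<in> C \<longleftrightarrow> I \<in> set (listed M)" if "I \<in> Pow {1, 2, 3} - {{}}" for I
    using M(2) that by (simp add: membership_def map_eq_conv set_region_list)
  have cancel: "\<rho> ` inv \<rho> ` I = I" "inv \<rho> ` \<rho> ` I = I" for I
    using permutes_inverses[OF perm] by (auto simp: image_image)
  have sub: "inv \<rho> ` I \<in> Pow {1, 2, 3} - {{}}" if "I \<in> Pow {1, 2, 3} - {{}}" for I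
    using that permutes_image[OF permutes_inv[OF perm]] by (metis Diff_iff PowD PowI empty_iff
        image_is_empty image_mono insert_iff)
  have listed_sub: "set (listed M) \<subseteq> Pow {1, 2, 3} - {{}}"
    using table_pairings M(1) by (simp add: set_region_list)
  have "(`) (inv \<rho>) ` C = set (listed M)"
  proof (intro equalityI subsetI)
    fix J assume "J \<in> (`) (inv \<rho>) ` C"
    then obtain I where "I \<in> C" "J = inv \<rho> ` I"
      by blast
    moreover from this have "J \<in> Pow {1, 2, 3} - {{}}"
      using C sub by blast
    ultimately show "J \<in> set (listed M)"
      using mem[of J] cancel(1)[of I] by metis
  next
    fix J assume J: "J \<in> set (listed M)"
    then have "\<rho> ` J \<in> C"
      using mem listed_sub by blast
    then have "inv \<rho> ` \<rho> ` J \<in> (`) (inv \<rho>) ` C"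
      by (rule imageI)
    then show "J \<in> (`) (inv \<rho>) ` C"
      by (simp only: cancel)
  qed
  then show ?thesis
    using that permutes_inv[OF perm] M(1) by blast
qed

lemma interval_3: "{1..3} = {1, 2, 3 :: nat}"
  by auto

lemma table_pairing_strategy:
  assumes board: "game_board k 3 B" and \<pi>: "\<pi> permutes {1, 2, 3}"
    and C: "(`) \<pi> ` odd_regions k 3 B = set (listed M)"
  shows "M \<in> set split_table \<Longrightarrow> has_pairing_strategy k 3 B Split"
    and "M \<in> set skew_table \<Longrightarrow> has_pairing_strategy k 3 B Skew"
proof -
  have perm: "\<pi> permutes {1..3}" "inv \<pi> permutes {1..3}"
    using \<pi> unfolding interval_3 by (simp_all only: permutes_inv)
  have "has_pairing_strategy k 3 B p"
    if "M \<in> set (split_table @ skew_table)" "\<And>d. d \<in> set (signed_sums M) \<Longrightarrow> favours 3 p d" for p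
  proof -
    have "region_pairing M (odd_regions k 3 (B \<circ> inv \<pi>))"
      using table_pairings that(1) by (simp add: region_pairing_def odd_regions_relabel[OF perm(1)] C)
    then have "has_pairing_strategy k 3 (B \<circ> inv \<pi>) p"
      using region_pairing_imp_pairing_strategy game_board_relabel[OF perm(2)] board that(2) by blast
    then show ?thesis
      by (simp add: pairing_strategy_relabel[OF perm(2)])
  qed
  moreover have "favours 3 Split d" if "M \<in> set split_table" "d \<in> set (signed_sums M)" for d
    using split_table_wins that unfolding favours_def interval_3 by blast
  moreover have "favours 3 Skew d" if "M \<in> set skew_table" "d \<in> set (signed_sums M)" for d
    using skew_table_wins that unfolding favours_def interval_3
    by (metis linorder_not_le player.distinct(1))
  ultimately show "M \<in> set split_table \<Longrightarrow> has_pairing_strategy k 3 B Split"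
    and "M \<in> set skew_table \<Longrightarrow> has_pairing_strategy k 3 B Skew"
    by simp_all
qed

section \<open>The winner of the splitting game\<close>

lemma two_sets_skew_wins:
  "\<forall>d \<in> set (signed_sums [({1}, {2}), ({1, 2}, {})]). \<exists>i \<in> {1, 2}. \<bar>d i\<bar> > 1"
  by code_simp

theorem theorem5p4:
  fixes k n :: nat and B :: "nat \<Rightarrow> nat set"
  assumes "game_board k n B" and "1 \<le> n" and "n \<le> 3"
  shows "\<exists>w.
    (\<forall>t p. has_winning_strategy k n B t p \<longleftrightarrow> p = w) \<and>
    (n = 1 \<longrightarrow> w = Split) \<and>
    (n = 2 \<longrightarrow>
       w = (if odd_regions k n B = {{1}, {2}, {1, 2}} then Skew else Split)) \<and>
    (n = 3 \<longrightarrow>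
       w = (if card (odd_regions k n B) \<le> 2 \<or>
               (\<exists>\<pi>. \<pi> permutes {1, 2, 3} \<and>
                  (\<lambda>I. \<pi> ` I) ` odd_regions k n B \<in>
                   {{{1}, {2}, {3}},
                    {{1}, {2}, {1, 3}},
                    {{1}, {1, 3}, {1, 2, 3}},
                    {{1}, {1, 2}, {1, 3}},
                    {{1, 2}, {1, 3}, {2, 3}, {1, 2, 3}},
                    {{3}, {2, 3}, {1, 2}, {1, 2, 3}},
                    {{2}, {3}, {2, 3}, {1, 2}},
                    {{2}, {3}, {2, 3}, {1, 2, 3}},
                    {{2}, {3}, {1, 2}, {1, 3}, {1, 2, 3}},
                    {{1}, {2}, {3}, {1, 2}, {1, 3}, {2, 3}}})
            then Split else Skew)) \<and>
    ((\<forall>I. I \<noteq> {} \<and> I \<subseteq> {1..n} \<longrightarrow> card (venn_region k n B I) \<le> 1) \<longrightarrow>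
       has_pairing_strategy k n B w)"
proof -
  let ?C = "odd_regions k n B"
  have C: "?C \<subseteq> Pow {1..n} - {{}}"
    by (auto simp: odd_regions_def)
  then have fin: "finite ?C"
    by (rule finite_subset) simp
  have win: ?thesis
    if w: "has_pairing_strategy k n B w"
      and "n = 1 \<longrightarrow> w = Split"
      and "n = 2 \<longrightarrow> w = (if ?C = {{1}, {2}, {1, 2}} then Skew else Split)"
      and "n = 3 \<longrightarrow> w = (if card ?C \<le> 2 \<or>
             (\<exists>\<pi>. \<pi> permutes {1, 2, 3} \<and> (\<lambda>I. \<pi> ` I) ` ?C \<in> (\<lambda>M. set (listed M)) ` set split_table)
           then Split else Skew)" for w
  proof -
    have "has_winning_strategy k n B t p \<longleftrightarrow> p = w" for t p
      using pairing_strategy_imp_winning_strategy[OF w] at_most_one_winner[of k n B t]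
      by (cases p; cases w) auto
    with that show ?thesis
      unfolding split_table_collections by (intro exI[of _ w]) blast
  qed
  show ?thesis
  proof (cases "card ?C \<le> 2")
    case True
    have "?C \<noteq> {{1}, {2}, {1, 2}}"
    proof
      assume "?C = {{1}, {2}, {1, 2}}"
      moreover have "card {{1}, {2}, {1, 2 :: nat}} = 3"
        by code_simp
      ultimately show False
        using True by simp
    qed
    moreover obtain M where "region_pairing M ?C" "\<And>d. d \<in> set (signed_sums M) \<Longrightarrow> favours n Split d"
      using few_odd_regions_pairing[OF fin True] C by blast
    then have "has_pairing_strategy k n B Split"
      by (rule region_pairing_imp_pairing_strategy[OF assms(1)])
    ultimately show ?thesis
      using True by (intro win[of Split]) auto
  next
    case False
    consider "n = 1" | "n = 2" | "n = 3"
      using assms(2,3) by linarith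
    then show ?thesis
    proof cases
      case 1
      then have "?C \<subseteq> {{1}}"
        using C by auto
      then have "card ?C \<le> 1"
        using card_mono[of "{{1}}" ?C] by simp
      with False show ?thesis by simp
    next
      case 2
      have "Pow {1..2} - {{}} = {{1}, {2}, {1, 2 :: nat}}"
        by code_simp
      then have "?C \<subseteq> {{1}, {2}, {1, 2}}"
        using C 2 by simp
      moreover have "card {{1}, {2}, {1, 2 :: nat}} = 3"
        by code_simp
      ultimately have C_eq: "?C = {{1}, {2}, {1, 2}}"
        using False by (intro card_seteq) auto
      have "region_pairing [({1}, {2}), ({1, 2}, {})] {{1}, {2}, {1, 2}}"
        unfolding region_pairing_def by code_simp
      moreover have "{1..2} = {1, 2 :: nat}"
        by auto
      then have "favours 2 Skew d" if "d \<in> set (signed_sums [({1}, {2}), ({1, 2}, {})])" for d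
        using two_sets_skew_wins that unfolding favours_def by (metis linorder_not_le player.distinct(1))
      ultimately have "has_pairing_strategy k n B Skew"
        using region_pairing_imp_pairing_strategy[OF assms(1)] C_eq 2 by metis
      then show ?thesis
        using 2 C_eq by (intro win[of Skew]) simp_all
    next
      case 3
      have board: "game_board k 3 B"
        using assms(1) 3 by simp
      show ?thesis
      proof (cases "\<exists>\<pi>. \<pi> permutes {1, 2, 3} \<and> (\<lambda>I. \<pi> ` I) ` ?C \<in> (\<lambda>M. set (listed M)) ` set split_table")
        case True
        then have "has_pairing_strategy k 3 B Split"
          using table_pairing_strategy(1)[OF board] 3 by blast
        then show ?thesis
          using 3 True by (intro win[of Split]) simp_all
      next
        case no_split: False
        obtain \<pi> M where \<pi>: "\<pi> permutes {1, 2, 3}" "M \<in> set (split_table @ skew_table)"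
            "(`) \<pi> ` ?C = set (listed M)"
        proof (rule tables_up_to_relabelling)
          show "?C \<subseteq> Pow {1, 2, 3} - {{}}"
            using C unfolding 3 interval_3 .
          show "2 < card ?C"
            using False by simp
        qed
        then have "M \<in> set skew_table"
          using no_split by auto
        then have "has_pairing_strategy k 3 B Skew"
          using table_pairing_strategy(2)[OF board] \<pi> 3 by blast
        then show ?thesis
          using 3 False no_split by (intro win[of Skew]) simp_all
      qed
    qed
  qed
qed

end
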